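(* Let $n$, $k_1$, $k_2$ be positive integers with $n\ge 2$ and $1\le k_1<k_2$. If $[-k_1,\,k_2]^*$ splits the cyclic group $\mathbb{Z}_{n(k_1+k_2)+1}$, then $k_1\le n-2$ and $k_2\le 2n-5$.
   Context: For integers $a\le b$, $[a,b]^*=\{a,a+1,\dots,b\}\setminus\{0\}$. For a finite abelian group $G$ (written additively), a set of integers $M$ and a subset $S\subseteq G$, we say $M$ splits $G$ (with splitter set $S$) if every nonzero $g\in G$ has a unique representation $g=ms$ with $m\in M$, $s\in S$, while $0$ has no such representation. Here $ms$ denotes the sum of $m$ copies of $s$ if $m\ge0$ and $-((-m)s)$ if $m<0$. *)

theory Defs
  imports "HOL-Algebra.Algebra"
begin

(* The set [a,b]^* of the nonzero integers in [a,b]. *)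
definition star_interval :: "int \<Rightarrow> int \<Rightarrow> int set" where
  "star_interval a b = {a..b} - {0}"

(* HOL-Algebra writes groups multiplicatively: the integer multiple m s is the integer
   power s [^] m and the neutral element 0 is \<one>. The notion is intended for finite
   abelian groups G. Uniqueness is that of the pair (m, s). *)
definition splits_with :: "('a, 'b) monoid_scheme \<Rightarrow> int set \<Rightarrow> 'a set \<Rightarrow> bool" where
  "splits_with G M S \<longleftrightarrow>
     S \<subseteq> carrier G \<and>
     (\<forall>g \<in> carrier G - {\<one>\<^bsub>G\<^esub>}. \<exists>!p. p \<in> M \<times> S \<and> g = snd p [^]\<^bsub>G\<^esub> fst p) \<and>
     \<not> (\<exists>m \<in> M. \<exists>s \<in> S. \<one>\<^bsub>G\<^esub> = s [^]\<^bsub>G\<^esub> m)"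

definition splits :: "int set \<Rightarrow> ('a, 'b) monoid_scheme \<Rightarrow> bool" where
  "splits M G \<longleftrightarrow> (\<exists>S. splits_with G M S)"

end

(* For two splitters s and u, the map (i, j) \<mapsto> i s + j u is
   injective on a subset of the integer plane as long as no difference of two of its points is a
   relation between s and u, so such a subset has at most N = n (k1 + k2) + 1 points. Relations with
   small coefficients are excluded by the splitting; relations with coefficients just outside the
   excluded range determine the second splitter, so for one of the n - 1 possible second splitters
   the first n - 2 possible coefficients do not occur, and a large planar set embeds.

   For k1 the relations are f u = g s with k2 < f \<le> k1 + k2 and \<bar>g\<bar> \<le> k1, and if k1 \<ge> n - 1 the
   count leaves only k1 = n - 1 and (k1 + k2) u = \<plusminus> s; multiplying by n turns this into - u = \<plusminus> n s, where
   n = k1 + 1 \<le> k2. For k2 they are d s + f u = 0 with k1 < d, f \<le> k2, and the count gives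
   2 k2 \<le> 2 n - 2 + k1 as soon as k2 \<ge> 2 n - 4. Together with k1 \<le> n - 2 this leaves just the groups
   of order 10 and 25, where the element 5 has no admissible representation. *)
theory Submission
  imports Defs
begin

section \<open>Counting tools\<close>

lemma pigeonhole_combination:
  fixes N s u :: int and P :: "(int \<times> int) set"
  assumes "finite P" and "N > 0" and "int (card P) > N"
  obtains i j i' j' where "(i, j) \<in> P" "(i', j') \<in> P" "(i, j) \<noteq> (i', j')" "j' \<le> j"
    "N dvd (i - i') * s + (j - j') * u"
proof -
  let ?h = "\<lambda>(i, j). (i * s + j * u) mod N"
  have "?h ` P \<subseteq> {0..<N}"
    using \<open>N > 0\<close> by auto
  then have "card (?h ` P) \<le> card {0..<N}"
    by (intro card_mono) auto
  then have "card (?h ` P) < card P"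
    using assms by simp
  then have "\<not> inj_on ?h P"
    by (rule pigeonhole)
  then obtain i j i' j' where *: "(i, j) \<in> P" "(i', j') \<in> P" "(i, j) \<noteq> (i', j')"
    "(i * s + j * u) mod N = (i' * s + j' * u) mod N"
    unfolding inj_on_def by auto
  from *(4) have "N dvd (i * s + j * u) - (i' * s + j' * u)"
    by (simp add: mod_eq_dvd_iff)
  moreover have "(i * s + j * u) - (i' * s + j' * u) = (i - i') * s + (j - j') * u"
    by (simp add: algebra_simps)
  ultimately have d: "N dvd (i - i') * s + (j - j') * u"
    by simp
  \<comment> \<open>Swapping the two points negates the combination, so their order can be chosen to
    make \<open>j' \<le> j\<close>.\<close>
  then have "N dvd - ((i - i') * s + (j - j') * u)"
    by (simp only: dvd_minus_iff)
  moreover have "- ((i - i') * s + (j - j') * u) = (i' - i) * s + (j' - j) * u"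
    by (simp add: algebra_simps)
  ultimately have d': "N dvd (i' - i) * s + (j' - j) * u"
    by simp
  show thesis
    using that[of i j i' j'] that[of i' j' i j] * d d' by fastforce
qed

text \<open>Allowing \<open>a = b + 1\<close> admits the empty interval, which occurs below for n =
  2.\<close>

lemma card_le_if_inj_on_atLeastAtMost:
  fixes a b :: int
  assumes "inj_on f A" and "f ` A \<subseteq> {a..b}" and "a \<le> b + 1"
  shows "int (card A) \<le> b + 1 - a"
proof -
  have "card A = card (f ` A)"
    using assms(1) by (simp add: card_image)
  also have "\<dots> \<le> card {a..b}"
    using assms(2) by (intro card_mono) auto
  finally show ?thesis
    using assms(3) by simp
qed

section \<open>Splittings of the cyclic group of order N as congruences between integers\<close>

locale interval_splitting =
  fixes k1 k2 N :: int and S :: "int set"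
  assumes k1: "1 \<le> k1" and k12: "k1 < k2"
    and finite_S: "finite S" and card_S: "card S \<ge> 2"
    and N_eq: "N = int (card S) * (k1 + k2) + 1"
    and nonzero: "\<And>m s. m \<in> star_interval (- k1) k2 \<Longrightarrow> s \<in> S \<Longrightarrow> \<not> N dvd m * s"
    and unique: "\<And>m s m' s'. m \<in> star_interval (- k1) k2 \<Longrightarrow> s \<in> S \<Longrightarrow>
      m' \<in> star_interval (- k1) k2 \<Longrightarrow> s' \<in> S \<Longrightarrow> N dvd m * s - m' * s' \<Longrightarrow> m = m' \<and> s = s'"
    and cover: "\<And>g. \<not> N dvd g \<Longrightarrow> \<exists>m\<in>star_interval (- k1) k2. \<exists>s\<in>S. N dvd g - m * s"
begin

lemma N_pos: "N > 0"
  using k1 k12 by (simp add: N_eq)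

text \<open>For \<open>f > k2\<close> the multipliers \<open>k2\<close> and \<open>k2 - f\<close>
  are both admissible, so f u = 0 would represent one element twice.\<close>

lemma multiple_nonzero:
  assumes "u \<in> S" and "0 < f" and "f \<le> k1 + k2"
  shows "\<not> N dvd f * u"
proof (cases "f \<le> k2")
  case True
  then show ?thesis
    using nonzero[of f u] assms k1 by (simp add: star_interval_def)
next
  case False
  show ?thesis
  proof
    assume "N dvd f * u"
    then have "N dvd k2 * u - (k2 - f) * u"
      by (simp add: algebra_simps)
    then have "k2 = k2 - f"
      using unique[of k2 u "k2 - f" u] False assms k1 k12 by (auto simp: star_interval_def)
    then show False
      using assms by simp
  qed
qed

lemma no_relation_aux:
  assumes "s \<in> S" "u \<in> S" "s \<noteq> u" and "N dvd x * s + y * u"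
    and "x \<in> {- k1..k2}" "- y \<in> {- k1..k2}"
  shows "x = 0 \<and> y = 0"
proof (cases "x = 0 \<or> y = 0")
  case True
  have "N dvd - (y * u)" if "x = 0"
    using assms(4) that by simp
  then show ?thesis
    using assms nonzero[of x s] nonzero[of "- y" u] True by (auto simp: star_interval_def)
next
  case False
  then have "s = u"
    using assms unique[of x s "- y" u] by (auto simp: star_interval_def)
  with assms show ?thesis by simp
qed

text \<open>Up to negating the relation, x and -y both lie in \<open>{- k1..k2}\<close>, and x s =
  (-y) u contradicts uniqueness. Within the bound \<open>k2\<close>, only coefficients of equal
  sign, both larger than \<open>k1\<close> in absolute value, escape.\<close>

lemma no_relation:
  assumes "s \<in> S" "u \<in> S" "s \<noteq> u" and "N dvd x * s + y * u"
    and "\<bar>x\<bar> \<le> k2" "\<bar>y\<bar> \<le> k2" and "\<bar>x\<bar> \<le> k1 \<or> \<bar>y\<bar> \<le> k1 \<or> x * y \<le> 0"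
  shows "x = 0 \<and> y = 0"
proof -
  have "N dvd - (x * s + y * u)"
    using assms(4) by (simp only: dvd_minus_iff)
  then have neg: "N dvd (- x) * s + (- y) * u"
    by (simp add: algebra_simps)
  have "(x \<in> {- k1..k2} \<and> - y \<in> {- k1..k2}) \<or> (- x \<in> {- k1..k2} \<and> - (- y) \<in> {- k1..k2})"
    using assms(5-7) k1 k12 by (auto simp: mult_le_0_iff)
  then show ?thesis
    using no_relation_aux[OF assms(1-4)] no_relation_aux[OF assms(1-3) neg] by auto
qed

section \<open>Relations with one coefficient beyond k2, and the bound on k1\<close>

definition mixed_relation :: "int \<Rightarrow> int \<Rightarrow> int \<Rightarrow> int \<Rightarrow> bool" where
  "mixed_relation s u g f \<longleftrightarrow> k2 < f \<and> f \<le> k1 + k2 \<and> \<bar>g\<bar> \<le> k1 \<and> N dvd f * u - g * s"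

lemma mixed_relation_nonzero: "u \<in> S \<Longrightarrow> mixed_relation s u g f \<Longrightarrow> g \<noteq> 0"
  using multiple_nonzero[of u f] k1 k12 by (auto simp: mixed_relation_def)

text \<open>Both g s and g' s' represent f u with admissible multipliers. Hence, for fixed u, the
  height f labels s injectively.\<close>

lemma mixed_relation_splitter_unique:
  assumes "s \<in> S" "s' \<in> S" "u \<in> S"
    and "mixed_relation s u g f" "mixed_relation s' u g' f"
  shows "g = g' \<and> s = s'"
proof -
  have "N dvd (f * u - g' * s') - (f * u - g * s)"
    using assms(4,5) unfolding mixed_relation_def by (blast intro: dvd_diff)
  then have "N dvd g * s - g' * s'"
    by simp
  moreover have "g \<in> star_interval (- k1) k2" "g' \<in> star_interval (- k1) k2"
    using mixed_relation_nonzero[OF \<open>u \<in> S\<close> assms(4)] mixed_relation_nonzero[OF \<open>u \<in> S\<close> assms(5)]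
      assms(4,5) k12 by (simp_all add: mixed_relation_def star_interval_def abs_le_iff)
  ultimately show ?thesis
    using unique assms(1,2) by blast
qed

text \<open>Subtracting the two relations leaves a coefficient of u of size at most
  \<open>k1\<close>, so \<open>no_relation\<close> forbids a small nonzero g - g'.\<close>

lemma mixed_relation_coeff_dist:
  assumes "s \<in> S" "u \<in> S" "s \<noteq> u"
    and "mixed_relation s u g f" "mixed_relation s u g' f'" "g \<noteq> g'"
  shows "\<bar>g - g'\<bar> > k2"
proof (rule ccontr)
  assume near: "\<not> ?thesis"
  have "N dvd (f' * u - g' * s) - (f * u - g * s)"
    using assms(4,5) unfolding mixed_relation_def by (blast intro: dvd_diff)
  then have "N dvd (g - g') * s + (f' - f) * u"
    by (simp add: algebra_simps)
  moreover have "\<bar>f' - f\<bar> \<le> k1"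
    using assms(4,5) by (auto simp: mixed_relation_def)
  ultimately show False
    using no_relation[OF assms(1-3), of "g - g'" "f' - f"] near k12 assms(6) by auto
qed

text \<open>The planar set is a full rectangle of height F with the columns in T prolonged upwards.
  A collision must be a mixed relation, of height at least F; its upper point then lies in a column
  i of T, and i + g is the column of the lower point, against \<open>avoid\<close>.\<close>

lemma mixed_relation_area:
  assumes su: "s \<in> S" "u \<in> S" "s \<noteq> u"
    and min: "\<And>g f. mixed_relation s u g f \<Longrightarrow> F \<le> f" and F: "k2 < F" "F \<le> k1 + k2 + 1"
    and T: "T \<subseteq> {0..k1}"
    and avoid: "\<And>i g f. i \<in> T \<Longrightarrow> mixed_relation s u g f \<Longrightarrow> i + g \<notin> {0..k1}"
  shows "(k1 + 1) * F + int (card T) * (k1 + k2 + 1 - F) \<le> N"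
proof (rule ccontr)
  assume less: "\<not> ?thesis"
  have finT: "finite T"
    using T finite_subset by blast
  define P where "P = {0..k1} \<times> {0..<F} \<union> T \<times> {F..k1 + k2}"
  have "card P = card ({0..k1} \<times> {0..<F}) + card (T \<times> {F..k1 + k2})"
    unfolding P_def using finT by (intro card_Un_disjoint) auto
  then have "int (card P) = (k1 + 1) * F + int (card T) * (k1 + k2 + 1 - F)"
    using k1 k12 F by (simp add: card_cartesian_product)
  moreover have "finite P"
    using finT by (simp add: P_def)
  ultimately obtain i e i' e' where ie: "(i, e) \<in> P" "(i', e') \<in> P" "(i, e) \<noteq> (i', e')" "e' \<le> e"
    and d: "N dvd (i - i') * s + (e - e') * u"
    using pigeonhole_combination[of P N s u] less N_pos by (metis not_le)
  have bnd: "0 \<le> i" "i \<le> k1" "0 \<le> i'" "i' \<le> k1" "0 \<le> e'" "e \<le> k1 + k2"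
    using ie(1,2) T F k1 k12 by (auto simp: P_def)
  have "\<not> e - e' \<le> k2"
  proof
    assume "e - e' \<le> k2"
    then have "\<bar>i - i'\<bar> \<le> k1" "\<bar>e - e'\<bar> \<le> k2"
      using bnd ie(4) by linarith+
    with k12 have "i - i' = 0 \<and> e - e' = 0"
      by (intro no_relation[OF su d]) auto
    then show False
      using ie(3) by simp
  qed
  then have rel: "mixed_relation s u (i' - i) (e - e')"
    using d bnd by (simp add: mixed_relation_def algebra_simps)
  from min[OF rel] have "i \<in> T"
    using ie(1) bnd by (auto simp: P_def)
  from avoid[OF this rel] show False
    using bnd by simp
qed

lemma avoiding_column:
  assumes su: "s \<in> S" "u \<in> S" "s \<noteq> u"
  obtains i where "i \<in> {0..k1}" "\<And>g f. mixed_relation s u g f \<Longrightarrow> i + g \<notin> {0..k1}"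
proof (cases "\<exists>g f. mixed_relation s u g f \<and> g > 0")
  case True
  then obtain g f where gf: "mixed_relation s u g f" "g > 0"
    by blast
  have gk: "g \<le> k1"
    using gf by (simp add: mixed_relation_def)
  show thesis
  proof (rule that)
    \<comment> \<open>This column is moved just past the right edge by g. Any other coefficient lies
      below g by more than \<open>k2\<close>, hence moves it past the left edge.\<close>
    show "k1 + 1 - g \<in> {0..k1}"
      using gf gk by simp
    fix g' f' assume rel: "mixed_relation s u g' f'"
    then have "\<bar>g'\<bar> \<le> k1"
      by (simp add: mixed_relation_def)
    then show "k1 + 1 - g + g' \<notin> {0..k1}"
      using mixed_relation_coeff_dist[OF su gf(1) rel] gf gk k12 by (cases "g = g'") auto
  qed
next
  case False
  show thesis
  proof (rule that)
    show "0 \<in> {0..k1}"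
      using k1 by simp
    fix g f assume rel: "mixed_relation s u g f"
    then have "g < 0"
      using False mixed_relation_nonzero[OF su(2) rel] by force
    then show "0 + g \<notin> {0..k1}"
      by simp
  qed
qed

lemma k1_le: "k1 \<le> int (card S) - 2"
proof (rule ccontr)
  define n where "n = int (card S)"
  assume "\<not> ?thesis"
  then have kn: "k1 \<ge> n - 1"
    by (simp add: n_def)
  have n2: "n \<ge> 2"
    using card_S by (simp add: n_def)
  have N: "N = n * (k1 + k2) + 1"
    by (simp add: N_eq n_def)
  obtain u where u: "u \<in> S"
    using card_S by (cases "S = {}") auto
  \<comment> \<open>There are n - 1 candidates s, but only n - 2 heights from \<open>k2 + 1\<close>
    to \<open>k2 + n - 2\<close>.\<close>
  have "\<exists>s\<in>S - {u}. \<forall>g f. mixed_relation s u g f \<longrightarrow> k2 + n - 1 \<le> f"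
  proof (rule ccontr)
    assume "\<not> ?thesis"
    then have "\<forall>s\<in>S - {u}. \<exists>f. f \<le> k2 + n - 2 \<and> (\<exists>g. mixed_relation s u g f)"
      by force
    then obtain f where f: "\<And>s. s \<in> S - {u} \<Longrightarrow> f s \<le> k2 + n - 2 \<and> (\<exists>g. mixed_relation s u g (f s))"
      by metis
    have "inj_on f (S - {u})"
    proof (rule inj_onI)
      fix s s' assume s: "s \<in> S - {u}" "s' \<in> S - {u}" "f s = f s'"
      then obtain g g' where "mixed_relation s u g (f s)" "mixed_relation s' u g' (f s)"
        using f by metis
      then show "s = s'"
        using mixed_relation_splitter_unique s u by blast
    qed
    moreover have "f ` (S - {u}) \<subseteq> {k2 + 1..k2 + n - 2}"
      using f by (fastforce simp: mixed_relation_def)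
    ultimately have "int (card (S - {u})) \<le> (k2 + n - 2) + 1 - (k2 + 1)"
      using n2 by (intro card_le_if_inj_on_atLeastAtMost) auto
    then show False
      using u finite_S card_S by (simp add: n_def)
  qed
  then obtain s where s: "s \<in> S" "s \<noteq> u"
    and min: "\<And>g f. mixed_relation s u g f \<Longrightarrow> k2 + n - 1 \<le> f"
    by blast
  note su = s(1) u s(2)
  obtain i where i: "i \<in> {0..k1}" "\<And>g f. mixed_relation s u g f \<Longrightarrow> i + g \<notin> {0..k1}"
    using avoiding_column[OF su] by blast
  \<comment> \<open>The \<open>k1 + 2 - n\<close> points of the extra column are just enough to turn
    the count into \<open>(k1 + 1) * k2 \<le> n * k2\<close>.\<close>
  have "(k1 + 1) * (k2 + n - 1) + int (card {i}) * (k1 + k2 + 1 - (k2 + n - 1)) \<le> N"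
    by (rule mixed_relation_area[OF su min]) (use n2 kn i in auto)
  then have "k1 * k2 + k2 \<le> n * k2"
    by (simp add: N algebra_simps)
  then have "(k1 + 1) * k2 \<le> n * k2"
    by (simp add: algebra_simps)
  then have "k1 = n - 1"
    using k1 k12 kn by (simp add: mult_le_cancel_right)
  have top: "f = k1 + k2" if "mixed_relation s u g f" for g f
  proof -
    have "f \<le> k1 + k2"
      using that by (simp add: mixed_relation_def)
    then show ?thesis
      using min[OF that] \<open>k1 = n - 1\<close> by linarith
  qed
  have "\<exists>g f. mixed_relation s u g f"
  proof (rule ccontr)
    assume none: "\<not> ?thesis"
    \<comment> \<open>With no relation the whole rectangle embeds; it has n (k1 + k2) + n points,
      more than N.\<close>
    have "(k1 + 1) * (k1 + k2 + 1) + int (card ({} :: int set)) * (k1 + k2 + 1 - (k1 + k2 + 1)) \<le> N"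
      by (rule mixed_relation_area[OF su]) (use none k1 in auto)
    then show False
      using \<open>k1 = n - 1\<close> n2 by (simp add: N algebra_simps)
  qed
  then obtain g where g: "mixed_relation s u g (k1 + k2)"
    using top by blast
  have g_unique: "g' = g" if "mixed_relation s u g' f" for g' f
    using mixed_relation_splitter_unique[OF s(1) s(1) u that] g top[OF that] by blast
  have "\<bar>g\<bar> = 1"
  proof (rule ccontr)
    assume "\<bar>g\<bar> \<noteq> 1"
    then have g2: "\<bar>g\<bar> \<ge> 2"
      using mixed_relation_nonzero[OF u g] by linarith
    have gk: "\<bar>g\<bar> \<le> k1"
      using g by (simp add: mixed_relation_def)
    \<comment> \<open>Since g is the only coefficient, \<open>\<bar>g\<bar> \<ge> 2\<close> frees
      two edge columns, and the count reaches n (k1 + k2) + 2 = N + 1.\<close>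
    define T where "T = (if g > 0 then {k1 - 1, k1} else {0, 1})"
    have "(k1 + 1) * (k1 + k2) + int (card T) * (k1 + k2 + 1 - (k1 + k2)) \<le> N"
    proof (rule mixed_relation_area[OF su])
      show "k1 + k2 \<le> f" if "mixed_relation s u g' f" for g' f
        using top[OF that] by simp
      show "i + g' \<notin> {0..k1}" if "i \<in> T" "mixed_relation s u g' f" for i g' f
        using g_unique[OF that(2)] that(1) g2 by (auto simp: T_def split: if_splits)
    qed (use k1 g2 gk in \<open>auto simp: T_def\<close>)
    moreover have "card T = 2"
      by (simp add: T_def)
    ultimately show False
      using \<open>k1 = n - 1\<close> by (simp add: N algebra_simps)
  qed
  \<comment> \<open>Modulo N, n (k1 + k2) is -1, so multiplying by n replaces the coefficient of u
    by a unit and that of s by a number of size n = k1 + 1, within reach of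
    \<open>no_relation\<close>.\<close>
  have "N dvd N * u - n * ((k1 + k2) * u - g * s)"
    using g by (simp add: mixed_relation_def)
  then have "N dvd (n * g) * s + 1 * u"
    by (simp add: N algebra_simps)
  moreover have "\<bar>n * g\<bar> \<le> k2"
    using \<open>\<bar>g\<bar> = 1\<close> \<open>k1 = n - 1\<close> k12 n2 by (simp add: abs_mult)
  ultimately show False
    using no_relation[OF su, of "n * g" 1] k1 k12 by auto
qed

section \<open>Relations with two large coefficients of equal sign, and the bound on k2\<close>

definition positive_relation :: "int \<Rightarrow> int \<Rightarrow> int \<Rightarrow> int \<Rightarrow> bool" where
  "positive_relation s u d f \<longleftrightarrow> k1 < d \<and> d \<le> k2 \<and> k1 < f \<and> f \<le> k2 \<and> N dvd d * s + f * u"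

text \<open>The planar set is L-shaped. A collision gives a positive relation (d, f), and
  \<open>d \<ge> D\<close> puts its upper right point in the low arm, where a vertical difference
  above \<open>k1\<close> is impossible.\<close>

lemma positive_relation_area:
  assumes su: "s \<in> S" "u \<in> S" "s \<noteq> u"
    and min: "\<And>d f. positive_relation s u d f \<Longrightarrow> D \<le> d" and D: "0 \<le> D" "D \<le> k2 + 1"
  shows "D * (k2 + 1) + (k2 + 1 - D) * (k1 + 1) \<le> N"
proof (rule ccontr)
  assume less: "\<not> ?thesis"
  define P where "P = {0..<D} \<times> {0..k2} \<union> {D..k2} \<times> {0..k1}"
  have "card P = card ({0..<D} \<times> {0..k2}) + card ({D..k2} \<times> {0..k1})"
    unfolding P_def by (intro card_Un_disjoint) auto
  then have "int (card P) = D * (k2 + 1) + (k2 + 1 - D) * (k1 + 1)"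
    using k1 k12 D by (simp add: card_cartesian_product)
  moreover have "finite P"
    by (simp add: P_def)
  ultimately obtain i j i' j' where ij: "(i, j) \<in> P" "(i', j') \<in> P" "(i, j) \<noteq> (i', j')" "j' \<le> j"
    and d: "N dvd (i - i') * s + (j - j') * u"
    using pigeonhole_combination[of P N s u] less N_pos by (metis not_le)
  have bnd: "0 \<le> i" "i \<le> k2" "0 \<le> i'" "i' \<le> k2" "0 \<le> j'" "j \<le> k2"
    using ij(1,2) D k1 k12 by (auto simp: P_def)
  have "\<bar>i - i'\<bar> \<le> k2" "\<bar>j - j'\<bar> \<le> k2"
    using bnd ij(4) by linarith+
  moreover have "\<not> (i - i' = 0 \<and> j - j' = 0)"
    using ij(3) by simp
  ultimately have "\<not> (\<bar>i - i'\<bar> \<le> k1 \<or> \<bar>j - j'\<bar> \<le> k1 \<or> (i - i') * (j - j') \<le> 0)"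
    using no_relation[OF su d] by blast
  then have large: "i - i' > k1" "j - j' > k1"
    using ij(4) by (auto simp: mult_le_0_iff)
  then have "positive_relation s u (i - i') (j - j')"
    using d bnd by (simp add: positive_relation_def)
  from min[OF this] show False
    using ij(1) bnd large by (auto simp: P_def)
qed

lemma k2_bound:
  assumes "k1 + int (card S) \<le> k2 + 2"
  shows "2 * k2 \<le> 2 * int (card S) - 2 + k1"
proof -
  define n where "n = int (card S)"
  have n2: "n \<ge> 2"
    using card_S by (simp add: n_def)
  obtain s where s: "s \<in> S"
    using card_S by (cases "S = {}") auto
  \<comment> \<open>Here s is fixed and the coefficient d labels u: n - 1 candidates compete for n -
    2 values.\<close>
  have "\<exists>u\<in>S - {s}. \<forall>d f. positive_relation s u d f \<longrightarrow> k1 + n - 1 \<le> d"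
  proof (rule ccontr)
    assume "\<not> ?thesis"
    then have "\<forall>u\<in>S - {s}. \<exists>d. d \<le> k1 + n - 2 \<and> (\<exists>f. positive_relation s u d f)"
      by force
    then obtain d where d: "\<And>u. u \<in> S - {s} \<Longrightarrow> d u \<le> k1 + n - 2 \<and> (\<exists>f. positive_relation s u (d u) f)"
      by metis
    have "inj_on d (S - {s})"
    proof (rule inj_onI)
      fix u u' assume u: "u \<in> S - {s}" "u' \<in> S - {s}" "d u = d u'"
      then obtain f f' where f: "positive_relation s u (d u) f" "positive_relation s u' (d u) f'"
        using d by metis
      have "N dvd (d u * s + f * u) - (d u * s + f' * u')"
        using f unfolding positive_relation_def by (blast intro: dvd_diff)
      then have "N dvd f * u - f' * u'"
        by simp
      then show "u = u'"
        using unique[of f u f' u'] f u k1 by (auto simp: positive_relation_def star_interval_def)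
    qed
    moreover have "d ` (S - {s}) \<subseteq> {k1 + 1..k1 + n - 2}"
      using d by (fastforce simp: positive_relation_def)
    ultimately have "int (card (S - {s})) \<le> (k1 + n - 2) + 1 - (k1 + 1)"
      using n2 by (intro card_le_if_inj_on_atLeastAtMost) auto
    then show False
      using s finite_S card_S by (simp add: n_def)
  qed
  then obtain u where u: "u \<in> S" "s \<noteq> u"
    and min: "\<And>d f. positive_relation s u d f \<Longrightarrow> k1 + n - 1 \<le> d"
    by blast
  \<comment> \<open>The hypothesis of the lemma says that \<open>D = k1 + n - 1\<close> is at most
    \<open>k2 + 1\<close>. After cancellation the count is \<open>k1\<close> times the
    claim.\<close>
  have "(k1 + n - 1) * (k2 + 1) + (k2 + 1 - (k1 + n - 1)) * (k1 + 1) \<le> N"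
    by (rule positive_relation_area[OF s u min]) (use assms n2 k1 in \<open>auto simp: n_def\<close>)
  then have "k1 * (2 * k2) \<le> k1 * (2 * n - 2 + k1)"
    by (simp add: N_eq n_def algebra_simps)
  then show ?thesis
    using k1 by (simp add: n_def)
qed

section \<open>The exceptional orders 10 and 25\<close>

lemma not_order_10: "\<not> (card S = 3 \<and> k1 = 1 \<and> k2 = 2)"
proof
  assume *: "card S = 3 \<and> k1 = 1 \<and> k2 = 2"
  then have N: "N = 10"
    by (simp add: N_eq)
  have "\<not> N dvd 5"
    by (simp add: N)
  then obtain m s where m: "m \<in> star_interval (- 1) 2" "s \<in> S" "10 dvd 5 - m * s"
    using cover[of 5] * by (auto simp: N)
  have "m = - 1 \<or> m = 1 \<or> m = 2"
    using m(1) by (auto simp: star_interval_def)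
  \<comment> \<open>By parity m is not 2, so s is 5 modulo 10.\<close>
  then have "10 dvd 2 * s"
    using m(3) by presburger
  then show False
    using nonzero[of 2 s] m(2) * by (simp add: N star_interval_def)
qed

lemma not_order_25: "\<not> (card S = 4 \<and> k1 = 2 \<and> k2 = 4)"
proof
  assume *: "card S = 4 \<and> k1 = 2 \<and> k2 = 4"
  then have N: "N = 25"
    by (simp add: N_eq)
  have "\<not> N dvd 5"
    by (simp add: N)
  then obtain m s where m: "m \<in> star_interval (- 2) 4" "s \<in> S" "25 dvd 5 - m * s"
    using cover[of 5] * by (auto simp: N)
  have "m = - 2 \<or> m = - 1 \<or> m = 1 \<or> m = 2 \<or> m = 3 \<or> m = 4"
    using m(1) by (auto simp: star_interval_def)
  \<comment> \<open>Every admissible m is prime to 5. Then 5 s = 0 modulo 25, so 4 s and -s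
    coincide.\<close>
  then have "5 dvd s"
    using m(3) by presburger
  then have "25 dvd 4 * s - (- 1) * s"
    by presburger
  then show False
    using unique[of 4 s "- 1" s] m(2) * by (simp add: N star_interval_def)
qed

lemma k2_le: "k2 \<le> 2 * int (card S) - 5"
proof (rule ccontr)
  assume large: "\<not> ?thesis"
  moreover note k1_le k1 k12
  moreover have "2 * k2 \<le> 2 * int (card S) - 2 + k1"
    by (rule k2_bound) (use large k1_le in linarith)
  \<comment> \<open>With n = \<open>card S\<close>, 4 n - 8 \<le> 2 k2 \<le> 2 n - 2 + k1 \<le> 3 n
    - 4 forces n \<le> 4, and \<open>1 \<le> k1\<close> rules out n = 2.\<close>
  ultimately have "(card S = 3 \<and> k1 = 1 \<and> k2 = 2) \<or> (card S = 4 \<and> k1 = 2 \<and> k2 = 4)"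
    by presburger
  then show False
    using not_order_10 not_order_25 by blast
qed

end

section \<open>Transfer from the group to integers\<close>

lemma splits_with_integer_mod_groupD:
  fixes n k1 k2 :: nat
  assumes n: "n \<ge> 2" and k: "1 \<le> k1" "k1 < k2"
    and split: "splits_with (integer_mod_group (n * (k1 + k2) + 1)) (star_interval (- int k1) (int k2)) S"
  shows "interval_splitting (int k1) (int k2) (int (n * (k1 + k2) + 1)) S" and "card S = n"
proof -
  define N where "N = int (n * (k1 + k2) + 1)"
  define M where "M = star_interval (- int k1) (int k2)"
  let ?h = "\<lambda>(m, s). (m * s) mod N"
  have N0: "N > 0"
    unfolding N_def by linarith
  have carrier: "carrier (integer_mod_group (n * (k1 + k2) + 1)) = {0..<N}"
    by (simp add: carrier_integer_mod_group N_def)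
  have pow: "s [^]\<^bsub>integer_mod_group (n * (k1 + k2) + 1)\<^esub> m = (m * s) mod N" for s m :: int
    by (simp only: int_pow_integer_mod_group N_def)
  have S: "S \<subseteq> {0..<N}"
    and rep: "\<And>g. g \<in> {0..<N} - {0} \<Longrightarrow> \<exists>!p. p \<in> M \<times> S \<and> g = (fst p * snd p) mod N"
    and zero: "\<And>m s. m \<in> M \<Longrightarrow> s \<in> S \<Longrightarrow> 0 \<noteq> (m * s) mod N"
    using split unfolding splits_with_def carrier pow one_integer_mod_group M_def[symmetric] by blast+
  have finS: "finite S"
    using S finite_subset by blast
  have in_range: "(m * s) mod N \<in> {0..<N} - {0}" if "m \<in> M" "s \<in> S" for m s
    using zero[OF that] N0 by auto
  have range: "?h p \<in> {0..<N} - {0}" if "p \<in> M \<times> S" for p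
    using in_range[of "fst p" "snd p"] that by (simp only: case_prod_beta mem_Times_iff)
  have inj: "inj_on ?h (M \<times> S)"
  proof (rule inj_onI)
    fix p q assume pq: "p \<in> M \<times> S" "q \<in> M \<times> S" "?h p = ?h q"
    from rep[OF range[OF pq(1)]] show "p = q"
      using pq unfolding case_prod_beta by blast
  qed
  have "?h ` (M \<times> S) = {0..<N} - {0}"
  proof
    show "?h ` (M \<times> S) \<subseteq> {0..<N} - {0}"
      using range by (rule image_subsetI)
    show "{0..<N} - {0} \<subseteq> ?h ` (M \<times> S)"
    proof
      fix g assume "g \<in> {0..<N} - {0}"
      from rep[OF this] show "g \<in> ?h ` (M \<times> S)"
        unfolding case_prod_beta by blast
    qed
  qed
  \<comment> \<open>Multiplication is a bijection from pairs to the N - 1 nonzero residues, which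
    determines the number of splitters.\<close>
  with inj have "card (M \<times> S) = card ({0..<N} - {0})"
    by (metis card_image)
  moreover have "card M = k1 + k2"
    using k by (simp add: M_def star_interval_def card_Diff_singleton)
  moreover have "nat N = n * (k1 + k2) + 1"
    unfolding N_def by (rule nat_int)
  ultimately have "(k1 + k2) * card S = n * (k1 + k2)"
    using N0 by (simp add: card_cartesian_product)
  then show card: "card S = n"
    using k by simp
  show "interval_splitting (int k1) (int k2) (int (n * (k1 + k2) + 1)) S"
    unfolding N_def[symmetric]
  proof (unfold_locales, unfold M_def[symmetric])
    fix m s assume "m \<in> M" "s \<in> S"
    then show "\<not> N dvd m * s"
      using zero by (metis dvd_imp_mod_0)
  next
    fix m s m' s' assume *: "m \<in> M" "s \<in> S" "m' \<in> M" "s' \<in> S" "N dvd m * s - m' * s'"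
    from *(5) have "?h (m, s) = ?h (m', s')"
      by (simp add: mod_eq_dvd_iff)
    then have "(m, s) = (m', s')"
      using inj * by (intro inj_onD[OF inj]) auto
    then show "m = m' \<and> s = s'"
      by simp
  next
    fix g assume "\<not> N dvd g"
    then have "g mod N \<in> {0..<N} - {0}"
      using N0 by (auto simp: dvd_eq_mod_eq_0)
    from rep[OF this] obtain m s where "m \<in> M" "s \<in> S" "g mod N = (m * s) mod N"
      by (metis mem_Times_iff)
    then show "\<exists>m\<in>M. \<exists>s\<in>S. N dvd g - m * s"
      by (auto simp: mod_eq_dvd_iff)
  qed (use k n finS card in \<open>auto simp: N_def\<close>)
qed

theorem theorem1p2:
  fixes n k1 k2 :: nat
  assumes "n \<ge> 2"
    and "1 \<le> k1"
    and "k1 < k2"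
    and "splits (star_interval (- int k1) (int k2)) (integer_mod_group (n * (k1 + k2) + 1))"
  shows "int k1 \<le> int n - 2 \<and> int k2 \<le> 2 * int n - 5"
proof -
  obtain S where "splits_with (integer_mod_group (n * (k1 + k2) + 1)) (star_interval (- int k1) (int k2)) S"
    using assms(4) unfolding splits_def by blast
  note S = splits_with_integer_mod_groupD[OF assms(1-3) this]
  show ?thesis
    using interval_splitting.k1_le[OF S(1)] interval_splitting.k2_le[OF S(1)] S(2) by simp
qed

end
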